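(* Let $X\subseteq\mathbb{R}^n$ be open and let $f:X\to\mathbb{R}$ be a continuous function that is Hadamard directionally differentiable at $\bar x\in X$ and whose directional derivative $f'(\bar x;\cdot)$ is a sublinear function. Then $$\operatorname{cl}\Bigg(\bigcup_{\substack{p\in \mathcal{S}\\ f'(\bar x;p)>0}}\ \operatorname*{Arg\,max}_{v\in\partial f(\bar x)}\langle v,p\rangle\Bigg)\ \subseteq\ \operatorname*{Lim\,sup}_{\substack{x\to\bar x\\ f(x)>f(\bar x)}}\partial f(x).$$
   Context: $\mathbb{R}^n$ carries the standard scalar product $\langle\cdot,\cdot\rangle$ and Euclidean norm $\|\cdot\|$; $\mathcal{S}$ is the unit sphere; $\operatorname{cl}$ denotes closure. A function $f:X\to\mathbb{R}$ is Hadamard directionally differentiable at $x\in X$ if for every $p\in\mathbb{R}^n$ the limit $f'(x;p)=\lim_{t\downarrow 0,\ p'\to p}\frac{f(x+tp')-f(x)}{t}$ exists and is finite; $f'(x;p)$ is the (Hadamard) directional derivative. Sublinear means convex and positively homogeneous of degree one. The Fréchet subdifferential of $f$ at $x\in X$ is $$\partial f(x)=\Big\{v\in\mathbb{R}^n\ \Big|\ \liminf_{z\to x,\ z\neq x}\frac{f(z)-f(x)-\langle v,z-x\rangle}{\|z-x\|}\ge 0\Big\}.$$ Outer limit: $\operatorname{Lim\,sup}_{x\to\bar x,\ f(x)>f(\bar x)}\partial f(x)$ is the set of all $y\in\mathbb{R}^n$ for which there exist sequences $x_k\to\bar x$ in $X$ with $f(x_k)>f(\bar x)$ and $y_k\in\partial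 f(x_k)$ with $y_k\to y$. *)

theory Defs
  imports "HOL-Analysis.Analysis"
begin

text \<open>
  A function on an open set \<open>X\<close> is modelled by a total function. The limits in the definitions
  of the derivative and of the subdifferential are local, so at points of an open \<open>X\<close> they do
  not depend on the values outside \<open>X\<close>.
\<close>

text \<open>The filter has \<open>t\<close> tending to \<open>0\<close> from the right and, jointly, \<open>q\<close> tending to \<open>p\<close>
  with \<open>q = p\<close> allowed.\<close>

definition hadamard_quotient_tendsto ::
    "('a::real_normed_vector \<Rightarrow> real) \<Rightarrow> 'a \<Rightarrow> 'a \<Rightarrow> real \<Rightarrow> bool" where
  "hadamard_quotient_tendsto f x p l \<longleftrightarrow>
     ((\<lambda>(t, q). (f (x + t *\<^sub>R q) - f x) / t) \<longlongrightarrow> l) (at_right 0 \<times>\<^sub>F nhds p)"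

definition hadamard_dir_differentiable ::
    "('a::real_normed_vector \<Rightarrow> real) \<Rightarrow> 'a \<Rightarrow> bool" where
  "hadamard_dir_differentiable f x \<longleftrightarrow> (\<forall>p. \<exists>l. hadamard_quotient_tendsto f x p l)"

definition hadamard_dir_deriv ::
    "('a::real_normed_vector \<Rightarrow> real) \<Rightarrow> 'a \<Rightarrow> 'a \<Rightarrow> real" where
  "hadamard_dir_deriv f x p = (THE l. hadamard_quotient_tendsto f x p l)"

definition sublinear :: "('a::real_vector \<Rightarrow> real) \<Rightarrow> bool" where
  "sublinear g \<longleftrightarrow> convex_on UNIV g \<and> (\<forall>t>0. \<forall>p. g (t *\<^sub>R p) = t * g p)"

definition frechet_subdifferential ::
    "('a::real_inner \<Rightarrow> real) \<Rightarrow> 'a \<Rightarrow> 'a set" where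
  "frechet_subdifferential f x =
     {v. Liminf (at x) (\<lambda>z. ereal ((f z - f x - v \<bullet> (z - x)) / norm (z - x))) \<ge> 0}"

definition Arg_max_set :: "'a set \<Rightarrow> ('a \<Rightarrow> real) \<Rightarrow> 'a set" where
  "Arg_max_set S g = {v. is_arg_max g (\<lambda>v. v \<in> S) v}"

definition outer_limit ::
    "('a::topological_space \<Rightarrow> 'b::topological_space set) \<Rightarrow> 'a set \<Rightarrow> 'a \<Rightarrow> 'b set" where
  "outer_limit F S a =
     {y. \<exists>xs ys. (\<forall>k::nat. xs k \<in> S \<and> ys k \<in> F (xs k)) \<and>
        xs \<longlonglongrightarrow> a \<and> ys \<longlonglongrightarrow> y}"

end

theory Submission
  imports Defs
begin

text \<open>
  Write \<open>g\<close> for the directional derivative at \<open>xbar\<close>. In finite dimension Hadamard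
  differentiability makes \<open>f (xbar + z) = f xbar + g z + o(norm z)\<close> uniform in the direction, so
  the Frechet subdifferential at \<open>xbar\<close> is the subdifferential of \<open>g\<close> at \<open>0\<close>, and, \<open>g\<close> being its
  support function, a maximiser \<open>v\<close> in direction \<open>p\<close> satisfies \<open>v \<bullet> p = g p\<close>. Hence
  \<open>f z - v \<bullet> z\<close> is, up to \<open>o(t)\<close>, minimal at \<open>xbar + t p\<close> among the points at distance \<open>O(t)\<close>.
  Adding the penalty \<open>(norm (z - xbar - t p))\<^sup>2 / t\<close> yields a genuine local minimiser at distance
  \<open>o(t)\<close> from \<open>xbar + t p\<close>; there \<open>f\<close> exceeds \<open>f xbar\<close> because \<open>g p > 0\<close>, and stationarity
  gives a Frechet subgradient close to \<open>v\<close>.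
\<close>

section \<open>Outer limits: approximation and closedness\<close>

text \<open>Eliminating sequences turns closedness into an \<open>e/2\<close> argument instead of a
  diagonal extraction, and lets the main construction supply a single point for each
  tolerance.\<close>

lemma outer_limit_iff:
  fixes F :: "'a::metric_space \<Rightarrow> 'b::metric_space set"
  shows "y \<in> outer_limit F S a \<longleftrightarrow>
    (\<forall>e>0. \<exists>x\<in>S. \<exists>w\<in>F x. dist x a < e \<and> dist w y < e)" (is "_ \<longleftrightarrow> ?R")
proof
  assume "y \<in> outer_limit F S a"
  then obtain xs ys where *: "\<And>k::nat. xs k \<in> S \<and> ys k \<in> F (xs k)"
    "xs \<longlonglongrightarrow> a" "ys \<longlonglongrightarrow> y"
    by (auto simp: outer_limit_def)
  show ?R
  proof (intro allI impI)
    fix e :: real assume "e > 0"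
    then have "\<forall>\<^sub>F k in sequentially. dist (xs k) a < e \<and> dist (ys k) y < e"
      using *(2,3) by (intro eventually_conj tendstoD)
    then obtain k where "dist (xs k) a < e \<and> dist (ys k) y < e"
      by (auto simp: eventually_sequentially)
    then show "\<exists>x\<in>S. \<exists>w\<in>F x. dist x a < e \<and> dist w y < e"
      using *(1) by blast
  qed
next
  assume R: ?R
  have "\<exists>x w. x \<in> S \<and> w \<in> F x \<and> dist x a < 1 / real (Suc k) \<and> dist w y < 1 / real (Suc k)" for k
    using R[rule_format, of "1 / real (Suc k)"] by auto
  then obtain xs ys where *: "\<And>k. xs k \<in> S" "\<And>k. ys k \<in> F (xs k)"
    "\<And>k. dist (xs k) a < 1 / real (Suc k)" "\<And>k. dist (ys k) y < 1 / real (Suc k)"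
    by metis
  have lim: "(\<lambda>k. 1 / real (Suc k)) \<longlonglongrightarrow> 0"
    using LIMSEQ_inverse_real_of_nat by (simp add: inverse_eq_divide)
  have "(\<lambda>k. dist (xs k) a) \<longlonglongrightarrow> 0"
    by (rule tendsto_sandwich[OF _ _ tendsto_const lim])
      (auto intro!: always_eventually less_imp_le[OF *(3)] simp del: of_nat_Suc)
  moreover have "(\<lambda>k. dist (ys k) y) \<longlonglongrightarrow> 0"
    by (rule tendsto_sandwich[OF _ _ tendsto_const lim])
      (auto intro!: always_eventually less_imp_le[OF *(4)] simp del: of_nat_Suc)
  ultimately have "xs \<longlonglongrightarrow> a" "ys \<longlonglongrightarrow> y"
    by (auto intro: tendsto_dist_iff[THEN iffD2])
  then show "y \<in> outer_limit F S a"
    using *(1,2) by (auto simp: outer_limit_def)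
qed

lemma closed_outer_limit:
  fixes F :: "'a::metric_space \<Rightarrow> 'b::metric_space set"
  shows "closed (outer_limit F S a)"
proof -
  have "y \<in> outer_limit F S a" if y: "y \<in> closure (outer_limit F S a)" for y
    unfolding outer_limit_iff
  proof (intro allI impI)
    fix e :: real assume e: "e > 0"
    then obtain y' where y': "y' \<in> outer_limit F S a" "dist y' y < e/2"
      using y unfolding closure_approachable by (meson half_gt_zero)
    then obtain x w where "x \<in> S" "w \<in> F x" "dist x a < e/2" "dist w y' < e/2"
      using e unfolding outer_limit_iff by (meson half_gt_zero)
    moreover have "dist w y < e"
      using calculation y'(2) dist_triangle_half_r[of y' w e y] by (simp add: dist_commute)
    ultimately show "\<exists>x\<in>S. \<exists>w\<in>F x. dist x a < e \<and> dist w y < e"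
      using e by (intro bexI[of _ x] bexI[of _ w]) auto
  qed
  then show ?thesis
    by (metis closure_subset closure_eq subsetI subset_antisym)
qed

section \<open>Frechet subgradients and quadratic penalties\<close>

lemma frechet_subdifferential_iff:
  "v \<in> frechet_subdifferential f x \<longleftrightarrow>
    (\<forall>e>0. \<forall>\<^sub>F z in at x. f z - f x - v \<bullet> (z - x) \<ge> - e * norm (z - x))" (is "_ \<longleftrightarrow> ?R")
proof -
  define q where "q = (\<lambda>z. (f z - f x - v \<bullet> (z - x)) / norm (z - x))"
  have ne: "\<forall>\<^sub>F z in at x. z \<noteq> x"
    by (simp add: eventually_at_filter)
  have "v \<in> frechet_subdifferential f x \<longleftrightarrow> (\<forall>y<0. \<forall>\<^sub>F z in at x. y < ereal (q z))"
    by (simp add: frechet_subdifferential_def le_Liminf_iff q_def)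
  also have "\<dots> \<longleftrightarrow> (\<forall>e>0. \<forall>\<^sub>F z in at x. - e \<le> q z)"
  proof (intro iffI allI impI)
    fix e :: real assume "\<forall>y<0. \<forall>\<^sub>F z in at x. y < ereal (q z)" "e > 0"
    then have "\<forall>\<^sub>F z in at x. ereal (- e) < ereal (q z)"
      by (elim allE[of _ "ereal (- e)"]) simp
    then show "\<forall>\<^sub>F z in at x. - e \<le> q z" by eventually_elim simp
  next
    fix y :: ereal assume *: "\<forall>e>0. \<forall>\<^sub>F z in at x. - e \<le> q z" and "y < 0"
    \<comment> \<open>The bound \<open>y\<close> may be minus infinity, so a real number is inserted
      between it and 0.\<close>
    then obtain r where r: "y < ereal r" "ereal r < 0"
      using ereal_dense2 by blast
    with *[rule_format, of "- r"] have "\<forall>\<^sub>F z in at x. r \<le> q z"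
      by simp
    then show "\<forall>\<^sub>F z in at x. y < ereal (q z)"
      by (rule eventually_mono) (use r in \<open>auto intro: less_le_trans\<close>)
  qed
  also have "\<dots> \<longleftrightarrow> ?R"
  proof -
    have "(\<forall>\<^sub>F z in at x. - e \<le> q z) \<longleftrightarrow>
        (\<forall>\<^sub>F z in at x. f z - f x - v \<bullet> (z - x) \<ge> - e * norm (z - x))" for e
    proof (intro eventually_cong[OF ne])
      fix z assume "z \<noteq> x"
      then show "- e \<le> q z \<longleftrightarrow> f z - f x - v \<bullet> (z - x) \<ge> - e * norm (z - x)"
        unfolding q_def by (simp only: pos_le_divide_eq zero_less_norm_iff right_minus_eq not_False_eq_True)
    qed
    then show ?thesis by simp
  qed
  finally show ?thesis .
qed

text \<open>The penalty is smooth with gradient \<open>2 * c\<close> times \<open>x - a\<close>, and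
  expanding the square leaves only \<open>c * (norm (w - x))\<^sup>2\<close>, which is of smaller
  order than \<open>norm (w - x)\<close>.\<close>

lemma frechet_subdifferential_of_penalized_min:
  fixes f :: "'a::real_inner \<Rightarrow> real"
  assumes c: "c \<ge> 0"
    and min: "\<forall>\<^sub>F w in at x. f x - v \<bullet> x + c * (norm (x - a))\<^sup>2 \<le> f w - v \<bullet> w + c * (norm (w - a))\<^sup>2"
  shows "v - (2 * c) *\<^sub>R (x - a) \<in> frechet_subdifferential f x"
  unfolding frechet_subdifferential_iff
proof (intro allI impI)
  fix e :: real assume e: "e > 0"
  \<comment> \<open>On this ball \<open>c * norm (w - x) \<le> e\<close>, which absorbs the
    quadratic remainder; the added 1 covers \<open>c = 0\<close>.\<close>
  have "\<forall>\<^sub>F w in at x. norm (w - x) < e / (c + 1)"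
    unfolding eventually_at by (rule exI[of _ "e / (c+1)"]) (use e c in \<open>auto simp: dist_norm\<close>)
  with min show "\<forall>\<^sub>F w in at x. f w - f x - (v - (2 * c) *\<^sub>R (x - a)) \<bullet> (w - x) \<ge> - e * norm (w - x)"
  proof eventually_elim
    case (elim w)
    have "(norm (w - a))\<^sup>2 = (norm (x - a))\<^sup>2 + 2 * ((x - a) \<bullet> (w - x)) + (norm (w - x))\<^sup>2"
      unfolding power2_norm_eq_inner by (simp add: algebra_simps inner_commute)
    from arg_cong[OF this, of "(*) c"] have "c * (norm (w - a))\<^sup>2 =
        c * (norm (x - a))\<^sup>2 + 2 * c * ((x - a) \<bullet> (w - x)) + c * (norm (w - x))\<^sup>2"
      by (simp add: distrib_left)
    moreover have "(v - (2 * c) *\<^sub>R (x - a)) \<bullet> (w - x) =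
        v \<bullet> w - v \<bullet> x - 2 * c * ((x - a) \<bullet> (w - x))"
      by (simp add: inner_diff_left inner_diff_right algebra_simps)
    moreover have "c * (norm (w - x))\<^sup>2 \<le> e * norm (w - x)"
    proof -
      have "norm (w - x) * (c + 1) \<le> e"
        using elim(2) c by (simp add: field_simps)
      then have "c * norm (w - x) \<le> e"
        unfolding distrib_left mult_1_right using norm_ge_zero[of "w - x"] mult.commute[of c "norm (w - x)"] by linarith
      then show ?thesis
        by (simp add: power2_eq_square mult_right_mono flip: mult.assoc)
    qed
    ultimately show ?case using elim(1) by linarith
  qed
qed

section \<open>Hadamard derivatives and the first-order expansion\<close>

text \<open>The filter is nontrivial, so limits are unique and the definite description picks the
  limit that exists.\<close>

lemma hadamard_quotient_tendsto_dir_deriv: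
  assumes "hadamard_dir_differentiable f x"
  shows "hadamard_quotient_tendsto f x p (hadamard_dir_deriv f x p)"
proof -
  have nb: "at_right (0::real) \<times>\<^sub>F nhds p \<noteq> bot"
    by (simp add: prod_filter_eq_bot)
  obtain l where l: "hadamard_quotient_tendsto f x p l"
    using assms by (auto simp: hadamard_dir_differentiable_def)
  then have "hadamard_dir_deriv f x p = l"
    unfolding hadamard_dir_deriv_def
    by (intro the_equality) (auto simp: hadamard_quotient_tendsto_def intro: tendsto_unique[OF nb])
  with l show ?thesis by simp
qed

text \<open>Homogeneity is stated for positive factors only; the factor 2 at the origin gives
  \<open>g 0 = 2 * g 0\<close>.\<close>

lemma sublinear_zero: "sublinear g \<Longrightarrow> g 0 = 0"
  unfolding sublinear_def by (drule conjunct2, drule spec[of _ 2], drule mp, simp, drule spec[of _ 0]) simp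

lemma sublinear_scaleR: "sublinear g \<Longrightarrow> t \<ge> 0 \<Longrightarrow> g (t *\<^sub>R p) = t * g p"
  using sublinear_zero[of g] by (cases "t = 0") (auto simp: sublinear_def)

lemma sublinear_continuous_on:
  fixes g :: "'a::euclidean_space \<Rightarrow> real"
  shows "sublinear g \<Longrightarrow> continuous_on UNIV g"
  using convex_on_continuous by (auto simp: sublinear_def)

text \<open>Uniformity in the direction comes from compactness of the sphere. Violating points
  \<open>z n\<close> tend to 0 and their directions \<open>u n\<close> accumulate at some
  \<open>p\<close>; along that subsequence both the difference quotient and \<open>g (u n)\<close>
  tend to \<open>g p\<close>, so the error cannot stay above \<open>e\<close>.\<close>

lemma sublinear_expansion_of_hadamard:
  fixes f :: "'a::euclidean_space \<Rightarrow> real"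
  assumes hd: "hadamard_dir_differentiable f x" and sub: "sublinear (hadamard_dir_deriv f x)"
    and e: "e > 0"
  obtains d where "d > 0"
    "\<And>z. norm z < d \<Longrightarrow> \<bar>f (x + z) - f x - hadamard_dir_deriv f x z\<bar> \<le> e * norm z"
proof -
  define g where "g = hadamard_dir_deriv f x"
  have "\<exists>d>0. \<forall>z. norm z < d \<longrightarrow> \<bar>f (x + z) - f x - g z\<bar> \<le> e * norm z"
  proof (rule ccontr)
    assume "\<not> ?thesis"
    then have "\<exists>z. norm z < 1 / real (Suc n) \<and> \<bar>f (x + z) - f x - g z\<bar> > e * norm z" for n
      by (metis divide_pos_pos not_le of_nat_0_less_iff zero_less_Suc zero_less_one)
    then obtain z where z: "\<And>n. norm (z n) < 1 / real (Suc n)"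
      "\<And>n. \<bar>f (x + z n) - f x - g (z n)\<bar> > e * norm (z n)"
      by metis
    have nz: "z n \<noteq> 0" for n
      using z(2)[of n] sublinear_zero[OF sub] by (auto simp: g_def)
    define u where "u = (\<lambda>n. z n /\<^sub>R norm (z n))"
    have "u n \<in> sphere 0 1" for n
      using nz by (simp add: u_def)
    then obtain p r where r: "strict_mono (r :: nat \<Rightarrow> nat)" "(u \<circ> r) \<longlonglongrightarrow> p"
      using compact_sphere[of "0::'a" 1] unfolding compact_def by meson
    have lim: "(\<lambda>n. 1 / real (Suc n)) \<longlonglongrightarrow> 0"
      using LIMSEQ_inverse_real_of_nat by (simp add: inverse_eq_divide)
    have nlim: "(\<lambda>n. norm (z n)) \<longlonglongrightarrow> 0"
      by (rule tendsto_sandwich[OF _ _ tendsto_const lim])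
        (auto intro!: always_eventually less_imp_le[OF z(1)] simp del: of_nat_Suc)
    have "filterlim (\<lambda>n. norm (z (r n))) (at_right 0) sequentially"
      unfolding filterlim_at
      using nz LIMSEQ_subseq_LIMSEQ[OF nlim r(1)] by (auto simp: o_def)
    moreover have ulim: "(\<lambda>n. u (r n)) \<longlonglongrightarrow> p"
      using r(2) by (simp add: o_def)
    \<comment> \<open>The direction varies together with the step length, so the joint Hadamard
      limit is essential here; limits along fixed rays would say nothing.\<close>
    ultimately have "filterlim (\<lambda>n. (norm (z (r n)), u (r n))) (at_right 0 \<times>\<^sub>F nhds p) sequentially"
      by (intro filterlim_Pair)
    then have "(\<lambda>n. (f (x + norm (z (r n)) *\<^sub>R u (r n)) - f x) / norm (z (r n))) \<longlonglongrightarrow> g p"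
      using hadamard_quotient_tendsto_dir_deriv[OF hd, of p]
      unfolding hadamard_quotient_tendsto_def g_def by (auto dest: filterlim_compose)
    moreover have "(\<lambda>n. g (u (r n))) \<longlonglongrightarrow> g p"
      using continuous_on_tendsto_compose[OF sublinear_continuous_on[OF sub] ulim] by (simp add: g_def)
    ultimately have "(\<lambda>n. (f (x + norm (z (r n)) *\<^sub>R u (r n)) - f x) / norm (z (r n)) - g (u (r n)))
        \<longlonglongrightarrow> g p - g p"
      by (rule tendsto_diff)
    then have "\<forall>\<^sub>F n in sequentially.
        dist ((f (x + norm (z (r n)) *\<^sub>R u (r n)) - f x) / norm (z (r n)) - g (u (r n))) 0 < e"
      using e by (intro tendstoD) simp_all
    then obtain n where n: "\<bar>(f (x + norm (z (r n)) *\<^sub>R u (r n)) - f x) / norm (z (r n)) - g (u (r n))\<bar> < e"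
      by (auto simp: eventually_sequentially)
    define s where "s = z (r n)"
    have s: "norm s > 0" "norm s *\<^sub>R u (r n) = s"
      using nz by (simp_all add: s_def u_def)
    have "g s = norm s * g (u (r n))"
      using sublinear_scaleR[OF sub, of "norm s" "u (r n)"] s(2) by (simp add: g_def)
    then have "f (x + s) - f x - g s = norm s * ((f (x + s) - f x) / norm s - g (u (r n)))"
      using s(1) by (simp add: field_simps)
    then have "\<bar>f (x + s) - f x - g s\<bar> =
        norm s * \<bar>(f (x + s) - f x) / norm s - g (u (r n))\<bar>"
      by (simp add: abs_mult)
    also have "\<dots> \<le> norm s * e"
      using n s unfolding s_def[symmetric] by (intro mult_left_mono) auto
    finally show False
      using z(2)[of "r n"] by (simp add: s_def mult.commute)
  qed
  then show ?thesis using that by (auto simp: g_def)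
qed

text \<open>Both inclusions use the expansion: along a ray the first-order terms of \<open>f\<close>
  and of \<open>v\<close> can be compared, and conversely a linear minorant of the derivative fails
  to minorise \<open>f\<close> only by the expansion error.\<close>

lemma frechet_subdifferential_hadamard:
  fixes f :: "'a::euclidean_space \<Rightarrow> real"
  assumes hd: "hadamard_dir_differentiable f x" and sub: "sublinear (hadamard_dir_deriv f x)"
  shows "frechet_subdifferential f x = {v. \<forall>q. v \<bullet> q \<le> hadamard_dir_deriv f x q}"
proof (intro equalityI subsetI CollectI allI)
  fix v q assume v: "v \<in> frechet_subdifferential f x"
  show "v \<bullet> q \<le> hadamard_dir_deriv f x q"
  proof (cases "q = 0")
    case True
    then show ?thesis using sublinear_zero[OF sub] by simp
  next
    case False
    show ?thesis
    proof (rule field_le_epsilon)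
      fix e0 :: real assume "e0 > 0"
      \<comment> \<open>The expansion and the subgradient inequality each cost
        \<open>e * (t * norm q)\<close>; together this is \<open>t * e0\<close>.\<close>
      define e where "e = e0 / (2 * norm q)"
      have e: "e > 0" using \<open>e0 > 0\<close> False by (simp add: e_def)
      obtain d1 where d1: "d1 > 0"
        "\<And>z. norm z < d1 \<Longrightarrow> \<bar>f (x + z) - f x - hadamard_dir_deriv f x z\<bar> \<le> e * norm z"
        using sublinear_expansion_of_hadamard[OF hd sub e] by blast
      obtain d2 where d2: "d2 > 0"
        "\<And>z. z \<noteq> x \<Longrightarrow> dist z x < d2 \<Longrightarrow> f z - f x - v \<bullet> (z - x) \<ge> - e * norm (z - x)"
        using v e unfolding frechet_subdifferential_iff eventually_at by blast
      define t where "t = min d1 d2 / (2 * norm q)"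
      have t: "t > 0" "t * norm q < d1" "t * norm q < d2"
        using d1(1) d2(1) False by (auto simp: t_def min_def)
      have "\<bar>f (x + t *\<^sub>R q) - f x - t * hadamard_dir_deriv f x q\<bar> \<le> e * (t * norm q)"
        using d1(2)[of "t *\<^sub>R q"] t sublinear_scaleR[OF sub, of t q] by simp
      moreover have "f (x + t *\<^sub>R q) - f x - t * (v \<bullet> q) \<ge> - e * (t * norm q)"
        using d2(2)[of "x + t *\<^sub>R q"] t False by (simp add: dist_norm)
      ultimately have "t * (v \<bullet> q) \<le> t * hadamard_dir_deriv f x q + 2 * e * (t * norm q)"
        by linarith
      also have "\<dots> = t * (hadamard_dir_deriv f x q + e0)"
        using False by (simp add: e_def field_simps)
      finally show "v \<bullet> q \<le> hadamard_dir_deriv f x q + e0"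
        using t(1) by simp
    qed
  qed
next
  fix v assume v: "v \<in> {v. \<forall>q. v \<bullet> q \<le> hadamard_dir_deriv f x q}"
  show "v \<in> frechet_subdifferential f x"
    unfolding frechet_subdifferential_iff
  proof (intro allI impI)
    fix e :: real assume "e > 0"
    then obtain d where d: "d > 0"
      "\<And>z. norm z < d \<Longrightarrow> \<bar>f (x + z) - f x - hadamard_dir_deriv f x z\<bar> \<le> e * norm z"
      using sublinear_expansion_of_hadamard[OF hd sub] by blast
    show "\<forall>\<^sub>F z in at x. f z - f x - v \<bullet> (z - x) \<ge> - e * norm (z - x)"
      unfolding eventually_at
    proof (intro exI[of _ d] conjI ballI impI)
      fix z assume "z \<noteq> x \<and> dist z x < d"
      then have "\<bar>f z - f x - hadamard_dir_deriv f x (z - x)\<bar> \<le> e * norm (z - x)"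
        using d(2)[of "z - x"] by (simp add: dist_norm)
      moreover have "v \<bullet> (z - x) \<le> hadamard_dir_deriv f x (z - x)"
        using v by simp
      ultimately show "f z - f x - v \<bullet> (z - x) \<ge> - e * norm (z - x)" by linarith
    qed (rule d(1))
  qed
qed

section \<open>The derivative as a support function\<close>

text \<open>A point strictly below the graph is separated from the closed convex epigraph. As the
  epigraph is a cone, the separating functional is nonnegative on it, and dividing by its positive
  vertical coefficient gives a linear minorant of \<open>g\<close>.\<close>

lemma sublinear_approx_subgradient:
  fixes g :: "'a::euclidean_space \<Rightarrow> real"
  assumes sub: "sublinear g" and h: "h > 0"
  obtains u where "\<And>q. u \<bullet> q \<le> g q" "u \<bullet> p > g p - h"
proof -
  define S where "S = epigraph UNIV g"
  have S: "(q, r) \<in> S \<longleftrightarrow> g q \<le> r" for q r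
    by (simp add: S_def epigraph_def)
  have "convex S"
    using sub by (simp add: S_def convex_epigraph sublinear_def)
  moreover have "closed S"
  proof -
    have "S = {y. g (fst y) \<le> snd y}"
      by (auto simp: S)
    moreover have "continuous_on UNIV (\<lambda>y::'a \<times> real. g (fst y))"
      by (rule continuous_on_compose2[OF sublinear_continuous_on[OF sub]]) (auto intro!: continuous_intros)
    ultimately show ?thesis
      by (auto intro!: closed_Collect_le continuous_intros)
  qed
  moreover have "(p, g p - h) \<notin> S"
    using h by (simp add: S)
  ultimately obtain a b where "a \<bullet> (p, g p - h) < b" "\<forall>y\<in>S. a \<bullet> y > b"
    using separating_hyperplane_closed_point[of S "(p, g p - h)"] by blast
  then obtain a1 \<alpha> where ab: "(a1, \<alpha>) \<bullet> (p, g p - h) < b" "\<forall>y\<in>S. (a1, \<alpha>) \<bullet> y > b"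
    by (cases a) blast
  have a: "a1 \<bullet> p + \<alpha> * (g p - h) < b"
    using ab(1) by simp
  have b: "a1 \<bullet> q + \<alpha> * r > b" if "g q \<le> r" for q r
    using ab(2)[rule_format, of "(q, r)"] that by (simp add: S)
  have "b < 0"
    using b[of 0 0] sublinear_zero[OF sub] by simp
  \<comment> \<open>The epigraph is a cone, so a functional bounded below on it is nonnegative on it.\<close>
  have nonneg: "a1 \<bullet> q + \<alpha> * r \<ge> 0" if "g q \<le> r" for q r
  proof (rule ccontr)
    define m where "m = a1 \<bullet> q + \<alpha> * r"
    assume "\<not> a1 \<bullet> q + \<alpha> * r \<ge> 0"
    then have m: "m < 0" by (simp add: m_def)
    \<comment> \<open>Scaling by this \<open>t\<close> brings the value \<open>m\<close> to exactly
      \<open>b\<close>, against the strict inequality on the epigraph.\<close>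
    define t where "t = b / m"
    have t: "t > 0" using m \<open>b < 0\<close> by (simp add: t_def divide_neg_neg)
    have "g (t *\<^sub>R q) \<le> t * r"
      using sublinear_scaleR[OF sub, of t q] t that by simp
    from b[OF this] have "t * m > b" by (simp add: m_def algebra_simps)
    then show False using m by (simp add: t_def)
  qed
  have "\<alpha> \<ge> 0"
    using nonneg[of 0 1] sublinear_zero[OF sub] by simp
  \<comment> \<open>A vertical hyperplane could not separate \<open>(p, g p - h)\<close> from the
    epigraph point \<open>(p, g p)\<close> above it.\<close>
  moreover have "\<alpha> \<noteq> 0"
  proof
    assume "\<alpha> = 0"
    then show False
      using a \<open>b < 0\<close> nonneg[of p "g p"] by simp
  qed
  ultimately have \<alpha>: "\<alpha> > 0" by simp
  show ?thesis
  proof (rule that[of "- (a1 /\<^sub>R \<alpha>)"])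
    show "- (a1 /\<^sub>R \<alpha>) \<bullet> q \<le> g q" for q
      using nonneg[of q "g q"] \<alpha> by (simp add: field_simps)
    show "- (a1 /\<^sub>R \<alpha>) \<bullet> p > g p - h"
      using a \<open>b < 0\<close> \<alpha> by (simp add: field_simps)
  qed
qed

text \<open>A maximiser is at least as good as every approximate subgradient in direction
  \<open>p\<close>, so letting the loss \<open>h\<close> tend to 0 suffices.\<close>

lemma Arg_max_set_inner_eq_dir_deriv:
  fixes f :: "'a::euclidean_space \<Rightarrow> real"
  assumes hd: "hadamard_dir_differentiable f x" and sub: "sublinear (hadamard_dir_deriv f x)"
    and v: "v \<in> Arg_max_set (frechet_subdifferential f x) (\<lambda>v. v \<bullet> p)"
  shows "v \<bullet> p = hadamard_dir_deriv f x p"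
proof (rule antisym)
  have v': "v \<in> frechet_subdifferential f x"
    "\<And>u. u \<in> frechet_subdifferential f x \<Longrightarrow> u \<bullet> p \<le> v \<bullet> p"
    using v by (auto simp: Arg_max_set_def is_arg_max_linorder)
  show "v \<bullet> p \<le> hadamard_dir_deriv f x p"
    using v'(1) frechet_subdifferential_hadamard[OF hd sub] by simp
  show "hadamard_dir_deriv f x p \<le> v \<bullet> p"
  proof (rule field_le_epsilon)
    fix h :: real assume "h > 0"
    then obtain u where u: "\<And>q. u \<bullet> q \<le> hadamard_dir_deriv f x q" "u \<bullet> p > hadamard_dir_deriv f x p - h"
      using sublinear_approx_subgradient[OF sub] by blast
    then have "u \<bullet> p \<le> v \<bullet> p"
      using v'(2) frechet_subdifferential_hadamard[OF hd sub] by blast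
    with u(2) show "hadamard_dir_deriv f x p \<le> v \<bullet> p + h" by linarith
  qed
qed

section \<open>Subgradients at nearby points with larger values\<close>

lemma exists_nearby_frechet_subgradient:
  fixes f :: "'a::euclidean_space \<Rightarrow> real"
  assumes X: "open X" "continuous_on X f" "x \<in> X"
    and hd: "hadamard_dir_differentiable f x" and sub: "sublinear (hadamard_dir_deriv f x)"
    and p: "norm p = 1" "hadamard_dir_deriv f x p > 0"
    and v: "v \<in> frechet_subdifferential f x" "v \<bullet> p = hadamard_dir_deriv f x p"
    and eta: "\<eta> > 0"
  shows "\<exists>z \<in> {z \<in> X. f z > f x}. \<exists>w \<in> frechet_subdifferential f z. dist z x < \<eta> \<and> dist w v < \<eta>"
proof -
  define g where "g = hadamard_dir_deriv f x"
  define G where "G = g p"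
  have G: "G > 0" "v \<bullet> p = G" using p v by (simp_all add: G_def g_def)
  have vg: "v \<bullet> q \<le> g q" for q
    using v(1) frechet_subdifferential_hadamard[OF hd sub] by (simp add: g_def)
  \<comment> \<open>\<open>\<delta>\<close> is the relative radius of the ball around
    \<open>x + t *\<^sub>R p\<close>. The bounds keep, in turn, the change
    \<open>2 * \<delta>\<close> of the subgradient below \<open>\<eta>\<close>, the ball within
    distance \<open>2 * t\<close> of \<open>x\<close>, and the variation of \<open>v\<close> on it
    below \<open>G/4 * t\<close>; the added 1 covers \<open>v = 0\<close>.\<close>
  define \<delta> where "\<delta> = min (\<eta>/4) (min (1/2) (G / (4 * (norm v + 1))))"
  have n1: "norm v + 1 > 0" by (simp add: add_nonneg_pos)
  have "G / (4 * (norm v + 1)) > 0"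
    using G(1) n1 by (intro divide_pos_pos) auto
  then have \<delta>: "\<delta> > 0" "\<delta> \<le> \<eta>/4" "\<delta> \<le> 1/2" "\<delta> \<le> G / (4 * (norm v + 1))"
    unfolding \<delta>_def using eta by linarith+
  have v\<delta>: "norm v * \<delta> \<le> G/4"
    using \<delta>(1,4) n1 by (simp add: field_simps)
  \<comment> \<open>The first bound gives \<open>3 * \<epsilon> < \<delta>\<^sup>2\<close>, which
    forces the minimiser into the open ball; the second keeps the error
    \<open>2 * \<epsilon> * t\<close> within \<open>G/4 * t\<close>.\<close>
  define \<epsilon> where "\<epsilon> = min (\<delta>\<^sup>2 / 4) (G/8)"
  have \<epsilon>: "\<epsilon> > 0" "\<epsilon> \<le> \<delta>\<^sup>2 / 4" "\<epsilon> \<le> G/8"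
    using \<delta>(1) G by (auto simp: \<epsilon>_def)
  obtain d where d: "d > 0" "\<And>y. norm y < d \<Longrightarrow> \<bar>f (x + y) - f x - g y\<bar> \<le> \<epsilon> * norm y"
    using sublinear_expansion_of_hadamard[OF hd sub \<epsilon>(1)] unfolding g_def by blast
  obtain d' where d': "d' > 0" "ball x d' \<subseteq> X"
    using X openE by blast
  define t where "t = min \<eta> (min d d') / 3"
  have t: "t > 0" "2 * t < \<eta>" "2 * t < d" "2 * t < d'"
    using eta d(1) d'(1) by (auto simp: t_def min_def)
  define a where "a = x + t *\<^sub>R p"
  define B where "B = cball a (\<delta> * t)"
  have B: "norm (z - x) \<le> 2 * t" if "z \<in> B" for z
  proof -
    have "norm (z - x) \<le> norm (z - a) + norm (a - x)"
      using norm_triangle_ineq[of "z - a" "a - x"] by simp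
    also have "\<dots> \<le> \<delta> * t + t"
      using that t(1) p(1) by (simp add: B_def a_def dist_norm norm_minus_commute)
    also have "\<dots> \<le> 2 * t"
      using \<delta>(3) t(1) by (simp add: field_simps)
    finally show ?thesis .
  qed
  have BX: "B \<subseteq> X"
    using B d'(2) t(4) by (force simp: dist_norm norm_minus_commute)
  have low: "f z - f x - v \<bullet> (z - x) \<ge> - (2 * \<epsilon> * t)" if "z \<in> B" for z
  proof -
    have "\<bar>f z - f x - g (z - x)\<bar> \<le> \<epsilon> * norm (z - x)"
      using d(2)[of "z - x"] B[OF that] t(3) by simp
    moreover have "\<epsilon> * norm (z - x) \<le> \<epsilon> * (2 * t)"
      using B[OF that] \<epsilon>(1) by (intro mult_left_mono) auto
    ultimately show ?thesis using vg[of "z - x"] by linarith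
  qed
  \<comment> \<open>With weight \<open>1/t\<close> the penalty is
    \<open>\<delta>\<^sup>2 * t\<close> on the boundary of \<open>B\<close>, beating errors of order
    \<open>\<epsilon> * t\<close>, while its gradient on \<open>B\<close> has norm at most
    \<open>2 * \<delta>\<close>.\<close>
  define \<phi> where "\<phi> = (\<lambda>z. f z - v \<bullet> z + (1/t) * (norm (z - a))\<^sup>2)"
  have "continuous_on B \<phi>"
    unfolding \<phi>_def using continuous_on_subset[OF X(2) BX] by (intro continuous_intros)
  moreover have "compact B"
    by (simp add: B_def)
  moreover have "a \<in> B"
    using \<delta>(1) t(1) by (simp add: B_def)
  ultimately obtain z where z: "z \<in> B" "\<And>y. y \<in> B \<Longrightarrow> \<phi> z \<le> \<phi> y"
    using continuous_attains_inf[of B \<phi>] by blast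
  \<comment> \<open>The penalty vanishes at the centre, and \<open>v \<bullet> p = G\<close> cancels
    the first-order growth of \<open>f\<close>.\<close>
  have "\<phi> a \<le> f x - v \<bullet> x + \<epsilon> * t"
  proof -
    have "\<bar>f a - f x - t * G\<bar> \<le> \<epsilon> * t"
      using d(2)[of "t *\<^sub>R p"] t(1,3) p(1) sublinear_scaleR[OF sub, of t p]
      by (simp add: a_def G_def g_def)
    moreover have "v \<bullet> a = v \<bullet> x + t * G"
      by (simp add: a_def inner_add_right G(2))
    ultimately show ?thesis by (simp add: \<phi>_def)
  qed
  \<comment> \<open>The upper error \<open>\<epsilon> * t\<close> at \<open>a\<close> and the lower
    error \<open>2 * \<epsilon> * t\<close> at \<open>z\<close> add up to the factor 3.\<close>
  with z(2)[OF \<open>a \<in> B\<close>] low[OF z(1)] have "(1/t) * (norm (z - a))\<^sup>2 \<le> 3 * \<epsilon> * t"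
    by (simp add: \<phi>_def inner_diff_right)
  then have "(norm (z - a))\<^sup>2 \<le> 3 * \<epsilon> * t\<^sup>2"
    using t(1) by (simp add: field_simps power2_eq_square)
  also have "\<dots> < \<delta>\<^sup>2 * t\<^sup>2"
    using \<epsilon>(1,2) t(1) by (intro mult_strict_right_mono) auto
  finally have za: "norm (z - a) < \<delta> * t"
    using \<delta>(1) t(1) by (simp add: power_mult_distrib[symmetric] power_less_imp_less_base)
  \<comment> \<open>Since \<open>z\<close> is interior, the minimum over \<open>B\<close> is an
    unconstrained local minimum and stationarity applies.\<close>
  then have "z \<in> ball a (\<delta> * t)"
    by (simp add: dist_norm norm_minus_commute)
  then have "\<forall>\<^sub>F w in at z. w \<in> ball a (\<delta> * t)"
    by (intro eventually_at_in_open') auto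
  then have "\<forall>\<^sub>F w in at z. \<phi> z \<le> \<phi> w"
    by eventually_elim (auto intro!: z(2) simp: B_def)
  then have w: "v - (2 * (1/t)) *\<^sub>R (z - a) \<in> frechet_subdifferential f z"
    using t(1) unfolding \<phi>_def by (intro frechet_subdifferential_of_penalized_min) auto
  have "norm ((2 * (1/t)) *\<^sub>R (z - a)) < \<eta>"
  proof -
    have "norm ((2 * (1/t)) *\<^sub>R (z - a)) = 2 * norm (z - a) / t"
      using t(1) by simp
    also have "\<dots> < 2 * \<delta>"
      using za t(1) by (simp add: field_simps)
    finally show ?thesis using \<delta>(2) eta by linarith
  qed
  then have wv: "dist (v - (2 * (1/t)) *\<^sub>R (z - a)) v < \<eta>"
    by (simp add: dist_norm)
  \<comment> \<open>From the growth \<open>t * G\<close> at most \<open>G/4 * t\<close> is lost by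
    moving from \<open>a\<close> to \<open>z\<close> and at most \<open>G/4 * t\<close> by the
    expansion error, leaving at least half.\<close>
  have "f z > f x"
  proof -
    have "v \<bullet> (z - x) = t * G + v \<bullet> (z - a)"
      by (simp add: a_def inner_diff_right inner_add_right G(2))
    moreover have "\<bar>v \<bullet> (z - a)\<bar> \<le> norm v * (\<delta> * t)"
      by (rule order_trans[OF Cauchy_Schwarz_ineq2]) (use za in \<open>intro mult_left_mono; simp\<close>)
    moreover have "norm v * (\<delta> * t) \<le> G/4 * t"
      using mult_right_mono[OF v\<delta>, of t] t(1) by (simp add: mult.assoc)
    moreover have "\<epsilon> * t \<le> G/8 * t"
      using \<epsilon>(3) t(1) by (intro mult_right_mono) auto
    moreover have "G * t > 0" using G t by simp
    ultimately show ?thesis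
      using low[OF z(1)] by (simp add: algebra_simps)
  qed
  then show ?thesis
    using w wv z(1) BX B[OF z(1)] t(2) by (intro bexI[of _ z] bexI[OF _ w]) (auto simp: dist_norm)
qed

theorem corollary2:
  fixes X :: "(real ^ 'n) set" and f :: "real ^ 'n \<Rightarrow> real" and xbar :: "real ^ 'n"
  assumes "open X"
    and "continuous_on X f"
    and "xbar \<in> X"
    and "hadamard_dir_differentiable f xbar"
    and "sublinear (hadamard_dir_deriv f xbar)"
  shows "closure (\<Union>p \<in> {p \<in> sphere 0 1. hadamard_dir_deriv f xbar p > 0}.
           Arg_max_set (frechet_subdifferential f xbar) (\<lambda>v. v \<bullet> p))
         \<subseteq> outer_limit (frechet_subdifferential f) {x \<in> X. f x > f xbar} xbar"
\<comment> \<open>The outer limit is closed, so only individual maximisers, not their limits, need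
  treatment.\<close>
proof (intro closure_minimal closed_outer_limit UN_least subsetI)
  fix p v
  assume p: "p \<in> {p \<in> sphere 0 1. hadamard_dir_deriv f xbar p > 0}"
    and v: "v \<in> Arg_max_set (frechet_subdifferential f xbar) (\<lambda>v. v \<bullet> p)"
  have "v \<in> frechet_subdifferential f xbar"
    using v by (simp add: Arg_max_set_def is_arg_max_def)
  moreover have "v \<bullet> p = hadamard_dir_deriv f xbar p"
    by (rule Arg_max_set_inner_eq_dir_deriv[OF assms(4,5) v])
  ultimately show "v \<in> outer_limit (frechet_subdifferential f) {x \<in> X. f x > f xbar} xbar"
    using p exists_nearby_frechet_subgradient[OF assms, of p v] by (simp add: outer_limit_iff)
qed

end
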